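(* A language $L$ is recursively enumerable if and only if $L=L(G,F)$ for some propagating context-free grammar $G=(V,T,P,S)$ with $\{0,1,\#\}\subseteq V$, where $F=\{w\#w^R\mid w\in\{0,1\}^*\}$ and the finalizing alphabet is $W=\{0,1,\#\}$.
   Context: A context-free grammar $G=(V,T,P,S)$ has total alphabet $V$, terminals $T\subseteq V$, nonterminals $N=V-T$, finite rules $P\subseteq N\times V^*$, start $S\in N$; it is propagating if every rule $A\to x$ has $x\neq\varepsilon$. $\phi(G)=\{w\in V^*\mid S\Rightarrow^*w\}$. For $X\subseteq V$, $\pi_X$ is the homomorphism from $V^*$ to $X^*$ keeping symbols of $X$ and erasing the others. For $W\subseteq V$ and $F\subseteq W^*$, $\phi(G,F)=\{x\in\phi(G)\mid\pi_W(x)\in F\}$ and $L(G,F)=\{\pi_T(y)\mid y\in\phi(G,F),\ \pi_{N-W}(y)=\varepsilon\}$. $w^R$ denotes the reversal of $w$.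
   Formalization: The formal theorem assumes that no word of L contains 0, 1 or #; without this the claim fails, e.g. L={0} is recursively enumerable, but every word of F has an even number of 0s, so L(G,F)={0} is impossible. *)

theory Defs
  imports Main
begin

record 'a cfg =
  cV :: "'a set"
  cT :: "'a set"
  cP :: "('a \<times> 'a list) set"
  cS :: 'a

definition cN :: "'a cfg \<Rightarrow> 'a set" where
  "cN G = cV G - cT G"

definition is_cfg :: "'a cfg \<Rightarrow> bool" where
  "is_cfg G \<longleftrightarrow> finite (cV G) \<and> cT G \<subseteq> cV G \<and> cS G \<in> cN G \<and> finite (cP G)
     \<and> (\<forall>(A, x) \<in> cP G. A \<in> cN G \<and> set x \<subseteq> cV G)"

definition propagating :: "'a cfg \<Rightarrow> bool" where
  "propagating G \<longleftrightarrow> (\<forall>(A, x) \<in> cP G. x \<noteq> [])"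

definition cfg_step :: "'a cfg \<Rightarrow> 'a list \<Rightarrow> 'a list \<Rightarrow> bool" where
  "cfg_step G w w' \<longleftrightarrow> (\<exists>u v A x. (A, x) \<in> cP G \<and> w = u @ [A] @ v \<and> w' = u @ x @ v)"

definition phi :: "'a cfg \<Rightarrow> 'a list set" where
  "phi G = {w. (cfg_step G)\<^sup>*\<^sup>* [cS G] w}"

definition proj :: "'a set \<Rightarrow> 'a list \<Rightarrow> 'a list" where
  "proj X w = filter (\<lambda>a. a \<in> X) w"

definition phiF :: "'a cfg \<Rightarrow> 'a set \<Rightarrow> 'a list set \<Rightarrow> 'a list set" where
  "phiF G W F = {x \<in> phi G. proj W x \<in> F}"

definition LGF :: "'a cfg \<Rightarrow> 'a set \<Rightarrow> 'a list set \<Rightarrow> 'a list set" where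
  "LGF G W F = {proj (cT G) y | y. y \<in> phiF G W F \<and> proj (cN G - W) y = []}"

record 'a ugrammar =
  uV :: "'a set"
  uT :: "'a set"
  uP :: "('a list \<times> 'a list) set"
  uS :: 'a

definition is_ugrammar :: "'a ugrammar \<Rightarrow> bool" where
  "is_ugrammar G \<longleftrightarrow> finite (uV G) \<and> uT G \<subseteq> uV G \<and> uS G \<in> uV G - uT G \<and> finite (uP G)
     \<and> (\<forall>(x, y) \<in> uP G. set x \<subseteq> uV G \<and> set y \<subseteq> uV G \<and> (\<exists>a \<in> set x. a \<notin> uT G))"

definition u_step :: "'a ugrammar \<Rightarrow> 'a list \<Rightarrow> 'a list \<Rightarrow> bool" where
  "u_step G w w' \<longleftrightarrow> (\<exists>u v x y. (x, y) \<in> uP G \<and> w = u @ x @ v \<and> w' = u @ y @ v)"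

definition u_lang :: "'a ugrammar \<Rightarrow> 'a list set" where
  "u_lang G = {w. set w \<subseteq> uT G \<and> (u_step G)\<^sup>*\<^sup>* [uS G] w}"

definition recursively_enumerable :: "'a list set \<Rightarrow> bool" where
  "recursively_enumerable L \<longleftrightarrow> (\<exists>G. is_ugrammar G \<and> u_lang G = L)"

definition Fpal :: "'a \<Rightarrow> 'a \<Rightarrow> 'a \<Rightarrow> 'a list set" where
  "Fpal zero one hash = {w @ [hash] @ rev w | w. w \<in> lists {zero, one}}"

end

theory Submission
  imports Defs
begin

text \<open>
  From an unrestricted grammar \<open>H\<close>, a linear grammar writes pairs of codes \<open>(c u, c v)\<close>, where
  \<open>u = v\<close> is a single symbol or \<open>u \<rightarrow> v\<close> is a rule, on the two sides of a nested structure, with an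
  offset of one sentential form. Requiring the two sides to be mirror images says
  \<open>x\<^sub>1 d \<dots> x\<^sub>n d = S d y\<^sub>1 d \<dots> y\<^sub>n\<^sub>-\<^sub>1 d\<close> with \<open>x\<^sub>i \<Rightarrow>\<^sup>* y\<^sub>i\<close>, hence
  \<open>S \<Rightarrow>\<^sup>* x\<^sub>n\<close>; while its code is written, the last form \<open>x\<^sub>n\<close> is also emitted in clear.

  Conversely, an unrestricted grammar can run the context-free grammar, freeze the symbols
  \<open>0\<close>, \<open>1\<close>, \<open>#\<close>, move the frozen symbols to the right of all terminals, and cancel them from the middle
  by \<open>a # a \<rightarrow> #\<close>. The last \<open>#\<close> may only be erased together with a symbol \<open>K\<close> that
  exists once, which excludes further occurrences of \<open>#\<close>.
\<close>

section \<open>String rewriting and context-free derivations\<close>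

definition rw_step :: "('a list \<times> 'a list) set \<Rightarrow> 'a list \<Rightarrow> 'a list \<Rightarrow> bool" where
  "rw_step R w w' \<longleftrightarrow> (\<exists>u v x y. (x, y) \<in> R \<and> w = u @ x @ v \<and> w' = u @ y @ v)"

definition cf_rules :: "('a \<times> 'a list) set \<Rightarrow> ('a list \<times> 'a list) set" where
  "cf_rules P = (\<lambda>(A, x). ([A], x)) ` P"

lemma u_step_eq: "u_step G = rw_step (uP G)"
  by (simp add: fun_eq_iff u_step_def rw_step_def)

lemma cfg_step_eq: "cfg_step G = rw_step (cf_rules (cP G))"
proof (intro ext)
  fix w w'
  show "cfg_step G w w' = rw_step (cf_rules (cP G)) w w'"
    unfolding cfg_step_def rw_step_def cf_rules_def by force
qed

lemma rw_stepI: "(x, y) \<in> R \<Longrightarrow> rw_step R (u @ x @ v) (u @ y @ v)"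
  unfolding rw_step_def by blast

lemma rw_step_mono: "rw_step R w w' \<Longrightarrow> R \<subseteq> R' \<Longrightarrow> rw_step R' w w'"
  unfolding rw_step_def by blast

lemma rw_steps_mono: "(rw_step R)\<^sup>*\<^sup>* w w' \<Longrightarrow> R \<subseteq> R' \<Longrightarrow> (rw_step R')\<^sup>*\<^sup>* w w'"
  using rtranclp_mono[of "rw_step R" "rw_step R'"] rw_step_mono by blast

lemma rw_step_context: "rw_step R w w' \<Longrightarrow> rw_step R (u @ w @ v) (u @ w' @ v)"
  unfolding rw_step_def by (metis append.assoc)

lemma rw_steps_context: "(rw_step R)\<^sup>*\<^sup>* w w' \<Longrightarrow> (rw_step R)\<^sup>*\<^sup>* (u @ w @ v) (u @ w' @ v)"
  by (induction rule: rtranclp_induct) (auto intro: rw_step_context rtranclp.rtrancl_into_rtrancl)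

lemma rw_steps_append:
  assumes "(rw_step R)\<^sup>*\<^sup>* u u'" "(rw_step R)\<^sup>*\<^sup>* v v'"
  shows "(rw_step R)\<^sup>*\<^sup>* (u @ v) (u' @ v')"
  using rw_steps_context[OF assms(1), of "[]" v] rw_steps_context[OF assms(2), of u' "[]"]
  by simp

lemma rw_steps_Cons: "(rw_step R)\<^sup>*\<^sup>* v v' \<Longrightarrow> (rw_step R)\<^sup>*\<^sup>* (a # v) (a # v')"
  using rw_steps_context[of R v v' "[a]" "[]"] by simp

lemma rw_rule: "(x, y) \<in> R \<Longrightarrow> (rw_step R)\<^sup>*\<^sup>* x y"
  using rw_stepI[of x y R "[]" "[]"] by simp

lemma rw_steps_set:
  assumes "(rw_step R)\<^sup>*\<^sup>* w w'" "\<And>x y. (x, y) \<in> R \<Longrightarrow> set y \<subseteq> A" "set w \<subseteq> A"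
  shows "set w' \<subseteq> A"
  using assms(1,3) by (induction rule: rtranclp_induct) (auto simp: rw_step_def dest!: assms(2))

text \<open>Every left-hand side is a single symbol, so each rewriting step lies entirely inside one
  of the two parts.\<close>

lemma cf_steps_split:
  assumes "(rw_step (cf_rules P))\<^sup>*\<^sup>* (u @ v) w"
  shows "\<exists>u' v'. w = u' @ v' \<and> (rw_step (cf_rules P))\<^sup>*\<^sup>* u u' \<and> (rw_step (cf_rules P))\<^sup>*\<^sup>* v v'"
  using assms
proof (induction rule: rtranclp_induct)
  case base
  then show ?case by blast
next
  case (step w1 w2)
  then obtain u' v' where w1: "w1 = u' @ v'" and u': "(rw_step (cf_rules P))\<^sup>*\<^sup>* u u'"
    and v': "(rw_step (cf_rules P))\<^sup>*\<^sup>* v v'" by blast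
  from step.hyps(2) obtain p q A x where r: "([A], x) \<in> cf_rules P"
    and e1: "w1 = p @ [A] @ q" and e2: "w2 = p @ x @ q"
    unfolding rw_step_def cf_rules_def by force
  from w1 e1 have "u' @ v' = p @ [A] @ q" by simp
  then consider r where "u' = p @ A # r" "q = r @ v'" | r where "p = u' @ r" "v' = r @ A # q"
    by (auto simp: append_eq_append_conv2 append_eq_Cons_conv)
  then show ?case
  proof cases
    case (1 s)
    then have "rw_step (cf_rules P) u' (p @ x @ s)" using rw_stepI[OF r, of p s] by simp
    then show ?thesis using u' v' e2 1
      by (intro exI[of _ "p @ x @ s"] exI[of _ v']) auto
  next
    case (2 s)
    then have "rw_step (cf_rules P) v' (s @ x @ q)" using rw_stepI[OF r, of s q] by simp
    then show ?thesis using u' v' e2 2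
      by (intro exI[of _ u'] exI[of _ "s @ x @ q"]) auto
  qed
qed

lemma cf_steps_irreducible:
  assumes "(rw_step (cf_rules P))\<^sup>*\<^sup>* m w" "set m \<inter> fst ` P = {}"
  shows "w = m"
  using assms by (induction rule: rtranclp_induct) (force simp: rw_step_def cf_rules_def)+

text \<open>An irreducible block separates the derivation into two independent halves, so any other
  block \<open>m'\<close> may be put in its place. This is what allows a checking step to be undone
  inside the result of a context-free derivation.\<close>

lemma cf_steps_around:
  assumes "(rw_step (cf_rules P))\<^sup>*\<^sup>* (u @ m @ v) w" "set m \<inter> fst ` P = {}"
  obtains u' v' where "w = u' @ m @ v'"
    "\<And>m'. (rw_step (cf_rules P))\<^sup>*\<^sup>* (u @ m' @ v) (u' @ m' @ v')"
    "(rw_step (cf_rules P))\<^sup>*\<^sup>* u u'" "(rw_step (cf_rules P))\<^sup>*\<^sup>* v v'"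
proof -
  from cf_steps_split[OF assms(1)] obtain u' w1 where w: "w = u' @ w1"
    and u': "(rw_step (cf_rules P))\<^sup>*\<^sup>* u u'" and "(rw_step (cf_rules P))\<^sup>*\<^sup>* (m @ v) w1"
    by blast
  from cf_steps_split[OF this(3)] obtain m' v' where w1: "w1 = m' @ v'"
    and m': "(rw_step (cf_rules P))\<^sup>*\<^sup>* m m'" and v': "(rw_step (cf_rules P))\<^sup>*\<^sup>* v v'"
    by blast
  show thesis
  proof (rule that)
    show "w = u' @ m @ v'" using w w1 cf_steps_irreducible[OF m' assms(2)] by simp
    show "(rw_step (cf_rules P))\<^sup>*\<^sup>* (u @ k @ v) (u' @ k @ v')" for k
      by (intro rw_steps_append u' v' rtranclp.rtrancl_refl)
  qed (use u' v' in auto)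
qed

section \<open>Projections, cutting lists, fresh symbols\<close>

lemma proj_simps [simp]:
  "proj X [] = []"
  "proj X (u @ v) = proj X u @ proj X v"
  "proj X (a # v) = (if a \<in> X then a # proj X v else proj X v)"
  "proj X (rev u) = rev (proj X u)"
  by (simp_all add: proj_def rev_filter)

lemma set_proj [simp]: "set (proj X w) = set w \<inter> X"
  by (auto simp: proj_def)

lemma proj_all: "set w \<subseteq> X \<Longrightarrow> proj X w = w"
  by (auto simp: proj_def intro!: filter_True)

lemma proj_none: "set w \<inter> X = {} \<Longrightarrow> proj X w = []"
  by (auto simp: proj_def filter_empty_conv)

lemma proj_empty_iff: "proj X w = [] \<longleftrightarrow> set w \<inter> X = {}"
  by (auto simp: proj_def filter_empty_conv)

text \<open>Both words are cut at their first \<open>x\<close>. Unlike in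
  \<open>append_Cons_eq_iff\<close>, \<open>x\<close> may recur in both remainders, as the separator
  \<open>d\<close> does in histories.\<close>

lemma append_Cons_eq_first:
  assumes "xs @ x # ys = xs' @ x # ys'" "x \<notin> set xs" "x \<notin> set xs'"
  shows "xs = xs' \<and> ys = ys'"
proof -
  have "takeWhile (\<lambda>y. y \<noteq> x) (zs @ x # ws) = zs" if "x \<notin> set zs" for zs ws
    using that by (induction zs) auto
  with assms have "xs = xs'" by metis
  with assms(1) show ?thesis by simp
qed

lemma fresh_sequence:
  assumes "infinite (UNIV :: 'a set)" "finite A"
  obtains f :: "nat \<Rightarrow> 'a" where "inj f" "\<And>n. f n \<notin> A"
proof -
  have "infinite (UNIV - A)" using assms by (simp add: Diff_infinite_finite)
  then obtain f :: "nat \<Rightarrow> 'a" where "inj f" "range f \<subseteq> UNIV - A"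
    using infinite_countable_subset by blast
  then show thesis by (intro that[of f]) auto
qed


section \<open>From constrained context-free derivations to unrestricted grammars\<close>

locale checking_grammar =
  fixes G :: "'a cfg" and zero one hash zero' one' hash' K start :: 'a
  assumes cfg: "is_cfg G"
    and bits: "distinct [zero, one, hash]" "{zero, one, hash} \<subseteq> cV G"
    and fresh: "distinct [zero', one', hash', K, start]"
      "set [zero', one', hash', K, start] \<inter> cV G = {}"
begin

definition W where "W = {zero, one, hash}"
text \<open>Symbols of \<open>W\<close> may be terminals of \<open>G\<close> but have to be
  rewritten in \<open>H\<close>. Dropping them loses nothing for a language whose words avoid
  \<open>W\<close>; see \<open>u_lang_H\<close>.\<close>

definition T where "T = cT G - W"
definition C where "C = {zero', one', hash', K}"
text \<open>Freezing is counted among the context-free rules, so the splitting lemmas cover it. No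
  rule of \<open>R\<close> rewrites a frozen symbol.\<close>

definition R where "R = cP G \<union> {(zero, [zero']), (one, [one']), (hash, [hash'])}"

text \<open>Symbols of \<open>C\<close> pass terminals only, never each other, so their mutual order
  is kept.\<close>

definition rules where
  "rules = cf_rules R \<union> {([c, t], [t, c]) | c t. c \<in> C \<and> t \<in> T}
     \<union> {([zero', hash', zero'], [hash']), ([one', hash', one'], [hash']), ([K, hash'], [])}
     \<union> {([start], [K, cS G])}"

definition H where "H = \<lparr>uV = cV G \<union> C \<union> {start}, uT = T, uP = rules, uS = start\<rparr>"

text \<open>These are the forms whose terminal projections make up the constrained language; see
  \<open>LGF_valid\<close>.\<close>

definition valid where
  "valid y \<longleftrightarrow> y \<in> phi G \<and> set y \<subseteq> cT G \<union> W \<and> proj W y \<in> Fpal zero one hash"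

lemma cP_D: "(A, x) \<in> cP G \<Longrightarrow> A \<in> cV G \<and> A \<notin> cT G \<and> set x \<subseteq> cV G"
  using cfg unfolding is_cfg_def cN_def by blast

lemma sets: "T \<subseteq> cV G" "cT G \<subseteq> cV G" "W \<subseteq> cV G" "C \<inter> cV G = {}" "T \<inter> W = {}" "T \<inter> C = {}"
  "start \<notin> C" "start \<notin> cV G" "cS G \<in> cV G" "cS G \<notin> cT G" "K \<in> C" "K \<notin> cV G"
  using cfg bits fresh unfolding is_cfg_def cN_def T_def W_def C_def by auto

lemma R_lhs: "a \<in> fst ` R \<Longrightarrow> a \<in> cV G - T"
  unfolding R_def using cP_D bits by (auto simp: T_def W_def)

lemma R_rhs: "(A, x) \<in> R \<Longrightarrow> set x \<subseteq> cV G \<union> (C - {K})"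
  unfolding R_def using cP_D fresh by (auto simp: C_def)

lemma irreducible: "set m \<subseteq> T \<union> C \<Longrightarrow> set m \<inter> fst ` R = {}"
  using R_lhs sets by blast

lemma is_ugrammar_H: "is_ugrammar H"
proof -
  have fin: "finite (cV G)" "finite (cP G)" "finite C" "finite T"
    using cfg finite_subset[of "cT G" "cV G"] unfolding is_cfg_def C_def T_def by auto
  have "{([c, t], [t, c]) | c t. c \<in> C \<and> t \<in> T} = (\<lambda>(c, t). ([c, t], [t, c])) ` (C \<times> T)"
    by auto
  with fin have "finite rules" unfolding rules_def cf_rules_def R_def by simp
  moreover have "set x \<subseteq> cV G \<union> C \<union> {start} \<and> set y \<subseteq> cV G \<union> C \<union> {start} \<and> (\<exists>a\<in>set x. a \<notin> T)"
    if "(x, y) \<in> rules" for x y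
    using that unfolding rules_def
  proof (elim UnE)
    assume "(x, y) \<in> cf_rules R"
    then obtain A where A: "x = [A]" "(A, y) \<in> R" unfolding cf_rules_def by auto
    then have "A \<in> fst ` R" by force
    then show ?thesis using R_lhs[of A] R_rhs[OF A(2)] A(1) by auto
  qed (use sets in \<open>auto simp: C_def\<close>)
  ultimately show ?thesis using fin sets unfolding is_ugrammar_def H_def by auto
qed

section \<open>Simulating a constrained derivation in \<open>H\<close>\<close>

lemma move_right: "c \<in> C \<Longrightarrow> set z \<subseteq> T \<Longrightarrow> (rw_step rules)\<^sup>*\<^sup>* (c # z) (z @ [c])"
proof (induction z)
  case (Cons t z)
  then have "([c, t], [t, c]) \<in> rules" unfolding rules_def by auto
  then have "rw_step rules ([] @ [c, t] @ z) ([] @ [t, c] @ z)" by (rule rw_stepI)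
  moreover have "(rw_step rules)\<^sup>*\<^sup>* (t # c # z) (t # z @ [c])"
    using Cons by (intro rw_steps_Cons) auto
  ultimately show ?case by (simp add: converse_rtranclp_into_rtranclp)
qed simp

lemma sort: "set y \<subseteq> T \<union> C \<Longrightarrow> (rw_step rules)\<^sup>*\<^sup>* y (proj T y @ proj C y)"
proof (induction y)
  case (Cons a y)
  then have IH: "(rw_step rules)\<^sup>*\<^sup>* (a # y) (a # proj T y @ proj C y)"
    by (intro rw_steps_Cons) auto
  show ?case
  proof (cases "a \<in> T")
    case True
    then show ?thesis using IH sets(6) by auto
  next
    case False
    with Cons.prems have a: "a \<in> C" by auto
    have "(rw_step rules)\<^sup>*\<^sup>* ((a # proj T y) @ proj C y) ((proj T y @ [a]) @ proj C y)"
      by (intro rw_steps_append move_right a) auto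
    with IH show ?thesis using False a by simp
  qed
qed simp

text \<open>The pair next to \<open>hash'\<close> is the last letter of \<open>w\<close>, hence the
  induction from the right. Once all pairs are gone, \<open>K\<close> meets
  \<open>hash'\<close>.\<close>

lemma cancel:
  "set w \<subseteq> {zero', one'} \<Longrightarrow> (rw_step rules)\<^sup>*\<^sup>* (K # w @ [hash'] @ rev w) []"
proof (induction w rule: rev_induct)
  case Nil
  then show ?case using rw_rule[of "[K, hash']" "[]" rules] by (simp add: rules_def)
next
  case (snoc a w)
  then have "([a, hash', a], [hash']) \<in> rules" by (auto simp: rules_def)
  then have "rw_step rules ((K # w) @ [a, hash', a] @ rev w) ((K # w) @ [hash'] @ rev w)"
    by (rule rw_stepI)
  with snoc show ?case by (simp add: converse_rtranclp_into_rtranclp)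
qed

definition disguise where
  "disguise a = (if a = zero then zero' else if a = one then one' else if a = hash then hash' else a)"

definition reveal where
  "reveal a = (if a = zero' then zero else if a = one' then one else if a = hash' then hash else a)"

lemma rules_R: "cf_rules R \<subseteq> rules"
  by (auto simp: rules_def)

lemma disguise_steps: "(rw_step rules)\<^sup>*\<^sup>* y (map disguise y)"
proof (induction y)
  case (Cons a y)
  have "(rw_step rules)\<^sup>*\<^sup>* [a] [disguise a]"
  proof (cases "a \<in> W")
    case True
    then have "([a], [disguise a]) \<in> cf_rules R"
      using bits unfolding cf_rules_def R_def disguise_def W_def by auto
    then show ?thesis using rules_R by (intro rw_rule) auto
  qed (simp add: disguise_def W_def)
  from rw_steps_append[OF this Cons] show ?case by simp
qed simp

lemma proj_disguise:
  assumes "set y \<subseteq> T \<union> W"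
  shows "proj T (map disguise y) = proj T y" "proj C (map disguise y) = map disguise (proj W y)"
    "set (map disguise y) \<subseteq> T \<union> C"
proof -
  have "proj T (map disguise y) = proj T y \<and> proj C (map disguise y) = map disguise (proj W y)
    \<and> set (map disguise y) \<subseteq> T \<union> C"
    using assms
  proof (induction y)
    case (Cons a y)
    have "disguise a = a" if "a \<in> T" using that sets by (auto simp: disguise_def W_def)
    moreover have "disguise a \<in> C" if "a \<in> W" using that by (auto simp: disguise_def W_def C_def)
    ultimately show ?case using Cons sets by auto
  qed simp
  then show "proj T (map disguise y) = proj T y" "proj C (map disguise y) = map disguise (proj W y)"
    "set (map disguise y) \<subseteq> T \<union> C" by auto
qed

lemma complete:
  assumes y: "valid y"
  shows "proj T y \<in> u_lang H"
proof -
  obtain w where w: "proj W y = w @ [hash] @ rev w" "set w \<subseteq> {zero, one}"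
    using y unfolding valid_def Fpal_def by (auto simp: lists_eq_set)
  have ys: "set y \<subseteq> T \<union> W" using y unfolding valid_def T_def by auto
  have "(rw_step (cf_rules (cP G)))\<^sup>*\<^sup>* [cS G] y"
    using y unfolding valid_def phi_def cfg_step_eq by simp
  moreover have "cf_rules (cP G) \<subseteq> rules" unfolding rules_def cf_rules_def R_def by auto
  ultimately have "(rw_step rules)\<^sup>*\<^sup>* [cS G] y" by (rule rw_steps_mono)
  then have "(rw_step rules)\<^sup>*\<^sup>* [cS G] (map disguise y)"
    using disguise_steps by (rule rtranclp_trans)
  then have 1: "(rw_step rules)\<^sup>*\<^sup>* [K, cS G] (K # map disguise y)" by (rule rw_steps_Cons)
  have disguise_hash: "disguise hash = hash'" using bits by (auto simp: disguise_def)
  have "proj T (K # map disguise y) = proj T y"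
    "proj C (K # map disguise y) = K # map disguise w @ [hash'] @ rev (map disguise w)"
    using proj_disguise[OF ys] sets w(1) disguise_hash by (auto simp: rev_map)
  moreover have "set (K # map disguise y) \<subseteq> T \<union> C" using proj_disguise[OF ys] sets by auto
  ultimately have 2: "(rw_step rules)\<^sup>*\<^sup>* (K # map disguise y)
      (proj T y @ K # map disguise w @ [hash'] @ rev (map disguise w))"
    using sort by metis
  have "set (map disguise w) \<subseteq> {zero', one'}" using w(2) bits by (auto simp: disguise_def)
  from rw_steps_context[OF cancel[OF this], of "proj T y" "[]"]
  have 3: "(rw_step rules)\<^sup>*\<^sup>*
      (proj T y @ K # map disguise w @ [hash'] @ rev (map disguise w)) (proj T y)" by simp
  have "(rw_step rules)\<^sup>*\<^sup>* [start] [K, cS G]" by (intro rw_rule) (simp add: rules_def)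
  with 1 2 3 have "(rw_step rules)\<^sup>*\<^sup>* [start] (proj T y)" by (meson rtranclp_trans)
  then show ?thesis unfolding u_lang_def H_def u_step_eq by simp
qed

text \<open>
  Read backwards, every checking step can be postponed after all context-free steps: the symbols
  it touches are not rewritten by \<open>R\<close>, so undoing it in the result of the context-free
  derivation again gives such a result.
\<close>

lemma sound_aux:
  assumes "(rw_step rules)\<^sup>*\<^sup>* s z" "set z \<subseteq> T"
  shows "start \<notin> set s \<Longrightarrow> count_list s K \<le> 1 \<Longrightarrow>
    \<exists>y. (rw_step (cf_rules R))\<^sup>*\<^sup>* s y \<and> set y \<subseteq> T \<union> C \<and> proj T y = z \<and>
      (proj C y = [] \<or> (\<exists>w. set w \<subseteq> {zero', one'} \<and> proj C y = K # w @ [hash'] @ rev w))"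
  using assms(1)
proof (induction rule: converse_rtranclp_induct)
  \<comment> \<open>The alternative \<open>proj C y = []\<close> describes the stage at which,
    reading backwards, the erasure of \<open>K\<close> has not yet been undone.\<close>
  case base
  have "set z \<inter> C = {}" using assms(2) sets by blast
  then show ?case using assms(2) by (intro exI[of _ z]) (simp add: proj_all proj_none subset_iff)
next
  case (step s s1)
  from step.hyps(1) obtain u v l r where r: "(l, r) \<in> rules" and s: "s = u @ l @ v"
    and s1: "s1 = u @ r @ v" unfolding rw_step_def by blast
  have l: "start \<notin> set l" using step.prems s by auto
  consider (cf) "(l, r) \<in> cf_rules R"
    | (move) c t where "c \<in> C" "t \<in> T" "l = [c, t]" "r = [t, c]"
    | (bit) b where "b \<in> {zero', one'}" "l = [b, hash', b]" "r = [hash']"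
    | (final) "l = [K, hash']" "r = []"
    using r l unfolding rules_def by auto
  then show ?case
  proof cases
    case cf
    then obtain A where A: "l = [A]" "(A, r) \<in> R" unfolding cf_rules_def by auto
    have "start \<notin> set r" "K \<notin> set r" using R_rhs[OF A(2)] sets by auto
    then have "start \<notin> set s1" "count_list s1 K \<le> 1"
      using step.prems s s1 by auto
    from step.IH[OF this] show ?thesis
      using rw_stepI[OF cf, of u v] s s1 by (metis converse_rtranclp_into_rtranclp)
  next
    case move
    have "start \<notin> set s1" "count_list s1 K \<le> 1"
      using step.prems s s1 move by auto
    from step.IH[OF this] obtain y where y: "(rw_step (cf_rules R))\<^sup>*\<^sup>* (u @ [t, c] @ v) y"
      "set y \<subseteq> T \<union> C" "proj T y = z"
      "proj C y = [] \<or> (\<exists>w. set w \<subseteq> {zero', one'} \<and> proj C y = K # w @ [hash'] @ rev w)"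
      using s1 move by auto
    obtain u' v' where y': "y = u' @ [t, c] @ v'"
      "(rw_step (cf_rules R))\<^sup>*\<^sup>* (u @ [c, t] @ v) (u' @ [c, t] @ v')"
      by (rule cf_steps_around[OF y(1) irreducible]) (use move in simp, blast)
    \<comment> \<open>Swapping a terminal with a symbol of \<open>C\<close> changes neither
      projection.\<close>
    have "t \<notin> C" "c \<notin> T" using move sets(6) by auto
    then have "proj T (u' @ [c, t] @ v') = proj T y" "proj C (u' @ [c, t] @ v') = proj C y"
      using y'(1) move by auto
    moreover have "set (u' @ [c, t] @ v') \<subseteq> T \<union> C" using y(2) y'(1) by auto
    moreover have "(rw_step (cf_rules R))\<^sup>*\<^sup>* s (u' @ [c, t] @ v')" using y'(2) s move by simp
    ultimately show ?thesis using y(3,4) by metis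
  next
    case bit
    have "start \<notin> set s1" "count_list s1 K \<le> 1"
      using step.prems s s1 bit fresh by auto
    from step.IH[OF this] obtain y where y: "(rw_step (cf_rules R))\<^sup>*\<^sup>* (u @ [hash'] @ v) y"
      "set y \<subseteq> T \<union> C" "proj T y = z"
      "proj C y = [] \<or> (\<exists>w. set w \<subseteq> {zero', one'} \<and> proj C y = K # w @ [hash'] @ rev w)"
      using s1 bit by auto
    obtain u' v' where y': "y = u' @ [hash'] @ v'"
      "(rw_step (cf_rules R))\<^sup>*\<^sup>* (u @ [b, hash', b] @ v) (u' @ [b, hash', b] @ v')"
      by (rule cf_steps_around[OF y(1) irreducible]) (simp add: C_def, blast)
    have C: "hash' \<in> C" "b \<in> C" "hash' \<notin> T" "b \<notin> T" using bit sets(6) by (auto simp: C_def)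
    \<comment> \<open>\<open>hash'\<close> occurs in \<open>y\<close>, which rules out the empty
      alternative.\<close>
    then obtain w where w: "set w \<subseteq> {zero', one'}"
      "proj C u' @ hash' # proj C v' = (K # w) @ hash' # rev w"
      using y(4) y'(1) by auto
    \<comment> \<open>\<open>hash'\<close> occurs only once in the palindrome, so the cut is at its
      centre, and restoring \<open>b\<close> on both sides appends one letter to
      \<open>w\<close>.\<close>
    have "hash' \<notin> set (K # w)" "hash' \<notin> set (rev w)" using w(1) fresh by auto
    from append_Cons_eq_iff[OF this] w(2) have "proj C u' = K # w \<and> proj C v' = rev w"
      by metis
    then have "proj C (u' @ [b, hash', b] @ v') = K # (w @ [b]) @ [hash'] @ rev (w @ [b])"
      using C by simp
    then have "\<exists>w. set w \<subseteq> {zero', one'} \<and>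
        proj C (u' @ [b, hash', b] @ v') = K # w @ [hash'] @ rev w"
      using w bit by (intro exI[of _ "w @ [b]"]) auto
    then show ?thesis using y y' s bit C by (intro exI[of _ "u' @ [b, hash', b] @ v'"]) auto
  next
    case final
    \<comment> \<open>The bound on the occurrences of \<open>K\<close> is used up by the pair being
      restored.\<close>
    have K: "K \<notin> set u" "K \<notin> set v"
      using step.prems s final by (auto simp: count_list_0_iff split: if_splits)
    have "start \<notin> set s1" "count_list s1 K \<le> 1"
      using step.prems s s1 final K by auto
    from step.IH[OF this] obtain y where y: "(rw_step (cf_rules R))\<^sup>*\<^sup>* (u @ [] @ v) y"
      "set y \<subseteq> T \<union> C" "proj T y = z"
      "proj C y = [] \<or> (\<exists>w. set w \<subseteq> {zero', one'} \<and> proj C y = K # w @ [hash'] @ rev w)"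
      using s1 final by auto
    obtain u' v' where y': "y = u' @ [] @ v'"
      "(rw_step (cf_rules R))\<^sup>*\<^sup>* (u @ [K, hash'] @ v) (u' @ [K, hash'] @ v')"
      by (rule cf_steps_around[OF y(1) irreducible]) (simp, blast)
    \<comment> \<open>No rule of \<open>R\<close> produces \<open>K\<close>, so \<open>y\<close> is
      free of it and the empty alternative holds: nothing frozen is left in \<open>y\<close>. The
      restored pair is then the whole frozen word, with \<open>w\<close> empty, which excludes a
      second separator.\<close>
    have "set y \<subseteq> - {K}"
      by (rule rw_steps_set[OF y(1)]) (use K R_rhs sets in \<open>force simp: cf_rules_def\<close>)+
    then have "K \<notin> set (proj C y)" by auto
    then have "proj C y = []" using y(4) by (metis list.set_intros(1))
    then have "proj C (u' @ [K, hash'] @ v') = K # [] @ [hash'] @ rev []"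
      using y'(1) by (simp add: C_def)
    then have "\<exists>w. set w \<subseteq> {zero', one'} \<and> proj C (u' @ [K, hash'] @ v') = K # w @ [hash'] @ rev w"
      by (intro exI[of _ "[]"]) auto
    moreover have "K \<notin> T" "hash' \<notin> T" "hash' \<in> C" using sets by (auto simp: C_def)
    ultimately show ?thesis using y y' s final sets(11)
      by (intro exI[of _ "u' @ [K, hash'] @ v'"]) auto
  qed
qed

section \<open>Recovering a derivation of \<open>G\<close>\<close>

lemma reveal_id: "set x \<subseteq> cV G \<Longrightarrow> map reveal x = x"
  using fresh by (induction x) (auto simp: reveal_def)

text \<open>Under \<open>reveal\<close> a freezing step becomes an equality, while a rule of
  \<open>G\<close> is unchanged because its symbols are not frozen copies.\<close>

lemma reveal_steps:
  assumes "(rw_step (cf_rules R))\<^sup>*\<^sup>* x y"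
  shows "(cfg_step G)\<^sup>*\<^sup>* (map reveal x) (map reveal y)"
  using assms
proof (induction rule: rtranclp_induct)
  case (step y1 y2)
  from step.hyps(2) obtain u v A r where r: "(A, r) \<in> R" and y: "y1 = u @ [A] @ v" "y2 = u @ r @ v"
    unfolding rw_step_def cf_rules_def by auto
  show ?case
  proof (cases "(A, r) \<in> cP G")
    case True
    then have "map reveal [A] = [A]" "map reveal r = r"
      using cP_D[OF True] reveal_id[of "[A]"] reveal_id[of r] by auto
    then have "cfg_step G (map reveal y1) (map reveal y2)"
      using True unfolding cfg_step_def y by auto
    with step.IH show ?thesis by auto
  next
    case False
    then have "map reveal [A] = map reveal r"
      using r bits fresh unfolding R_def by (auto simp: reveal_def)
    then have "map reveal y1 = map reveal y2" unfolding y by simp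
    with step.IH show ?thesis by simp
  qed
qed simp

lemma proj_reveal:
  assumes "set y \<subseteq> T \<union> (C - {K})"
  shows "proj T (map reveal y) = proj T y" "proj W (map reveal y) = map reveal (proj C y)"
    "set (map reveal y) \<subseteq> T \<union> W"
proof -
  have "proj T (map reveal y) = proj T y \<and> proj W (map reveal y) = map reveal (proj C y)
    \<and> set (map reveal y) \<subseteq> T \<union> W"
    using assms
  proof (induction y)
    case (Cons a y)
    have "reveal a = a" if "a \<in> T" using that sets by (auto simp: reveal_def C_def)
    moreover have "reveal a \<in> W" if "a \<in> C - {K}" using that by (auto simp: reveal_def W_def C_def)
    ultimately show ?case using Cons sets by auto
  qed simp
  then show "proj T (map reveal y) = proj T y" "proj W (map reveal y) = map reveal (proj C y)"
    "set (map reveal y) \<subseteq> T \<union> W" by auto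
qed

lemma sound:
  assumes "z \<in> u_lang H"
  shows "\<exists>y. valid y \<and> z = proj T y"
proof -
  have z: "set z \<subseteq> T" and d: "(rw_step rules)\<^sup>*\<^sup>* [start] z"
    using assms unfolding u_lang_def H_def u_step_eq by auto
  have "z \<noteq> [start]" using z sets by auto
  then obtain s where s: "rw_step rules [start] s" "(rw_step rules)\<^sup>*\<^sup>* s z"
    using d by (metis converse_rtranclpE)
  from s(1) obtain u v l r where lr: "(l, r) \<in> rules" "[start] = u @ l @ v" "s = u @ r @ v"
    unfolding rw_step_def by blast
  \<comment> \<open>Each left-hand side contains a nonterminal and so is nonempty; it must be all of
    \<open>[start]\<close>.\<close>
  have "l \<noteq> []" using is_ugrammar_H lr(1) unfolding is_ugrammar_def H_def by force
  then have l: "u = []" "v = []" "l = [start]"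
    using lr(2) by (auto simp: Cons_eq_append_conv)
  have "start \<notin> fst ` R" using R_lhs sets by auto
  then have "([start], r) \<notin> cf_rules R" unfolding cf_rules_def by force
  then have "r = [K, cS G]" using lr(1) l(3) fresh unfolding rules_def by auto
  then have s': "s = [K, cS G]" unfolding lr(3) l by simp
  have "start \<notin> set s" "count_list s K \<le> 1" using sets s' by auto
  from sound_aux[OF s(2) z this] obtain y where
    y: "(rw_step (cf_rules R))\<^sup>*\<^sup>* s y" "set y \<subseteq> T \<union> C" "proj T y = z"
      "proj C y = [] \<or> (\<exists>w. set w \<subseteq> {zero', one'} \<and> proj C y = K # w @ [hash'] @ rev w)"
    by (elim exE conjE)
  \<comment> \<open>\<open>K\<close> is treated as an irreducible block with nothing to its left, so
    the rest \<open>x\<close> of \<open>y\<close> comes from \<open>cS G\<close> alone.\<close>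
  have "(rw_step (cf_rules R))\<^sup>*\<^sup>* ([] @ [K] @ [cS G]) y" using y(1) s' by simp
  then obtain u' x where x: "y = u' @ [K] @ x" "(rw_step (cf_rules R))\<^sup>*\<^sup>* [] u'"
    "(rw_step (cf_rules R))\<^sup>*\<^sup>* [cS G] x"
    by (rule cf_steps_around[OF _ irreducible]) (use sets in simp, blast)
  have "u' = []" using cf_steps_irreducible[OF x(2)] by simp
  with x have yx: "y = K # x" by simp
  have "set x \<subseteq> - {K}"
    by (rule rw_steps_set[OF x(3)]) (use R_rhs sets in \<open>force simp: cf_rules_def\<close>)+
  with y(2) yx have xs: "set x \<subseteq> T \<union> (C - {K})" by auto
  \<comment> \<open>The occurrence of \<open>K\<close> in \<open>y\<close> rules out the empty
    alternative.\<close>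
  obtain w where w: "set w \<subseteq> {zero', one'}" "proj C x = w @ [hash'] @ rev w"
    using y(4) yx sets by auto
  let ?y = "map reveal x"
  have "(cfg_step G)\<^sup>*\<^sup>* [cS G] ?y"
    using reveal_steps[OF x(3)] reveal_id[of "[cS G]"] sets by simp
  moreover have "set ?y \<subseteq> cT G \<union> W" using proj_reveal(3)[OF xs] by (auto simp: T_def)
  moreover have "reveal hash' = hash" using fresh by (auto simp: reveal_def)
  then have "proj W ?y = map reveal w @ [hash] @ rev (map reveal w)"
    using proj_reveal(2)[OF xs] w(2) by (simp add: rev_map)
  moreover have "map reveal w \<in> lists {zero, one}"
    using w(1) fresh by (auto simp: reveal_def)
  ultimately have "valid ?y" unfolding valid_def phi_def Fpal_def by blast
  moreover have "z = proj T ?y" using proj_reveal(1)[OF xs] y(3) yx sets by auto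
  ultimately show ?thesis by blast
qed

text \<open>Sentential forms stay inside \<open>cV G\<close>, so containing nothing from
  \<open>cN G - W\<close> amounts to consisting of \<open>cT G\<close> and \<open>W\<close>.\<close>

lemma LGF_valid: "LGF G {zero, one, hash} (Fpal zero one hash) = proj (cT G) ` {y. valid y}"
proof -
  have "set y \<subseteq> cV G" if "y \<in> phi G" for y
    using that cP_D sets unfolding phi_def cfg_step_eq
    by (auto simp: cf_rules_def dest!: rw_steps_set[where A = "cV G"])
  then show ?thesis
    unfolding LGF_def phiF_def proj_empty_iff valid_def W_def[symmetric] cN_def by blast
qed

text \<open>Since words of \<open>L\<close> avoid \<open>W\<close>, projecting a valid form to
  \<open>T\<close> or to \<open>cT G\<close> gives the same word.\<close>

lemma u_lang_H:
  assumes L: "L = LGF G {zero, one, hash} (Fpal zero one hash)"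
    and no: "\<forall>w\<in>L. set w \<inter> {zero, one, hash} = {}"
  shows "u_lang H = L"
proof -
  have no': "set (proj (cT G) y) \<inter> W = {}" if "valid y" for y
    using that no unfolding L LGF_valid W_def by blast
  have "proj T y = proj (cT G) y" if "valid y" for y
    using no'[OF that] unfolding proj_def T_def by (auto intro!: filter_cong)
  then show ?thesis using complete sound unfolding L LGF_valid by force
qed

end


section \<open>From unrestricted grammars to constrained context-free derivations\<close>

text \<open>Each symbol is written in unary and closed by \<open>zero\<close>. This is a prefix code
  as soon as \<open>idx\<close> is injective on the alphabet.\<close>

definition code :: "('a \<Rightarrow> nat) \<Rightarrow> 'b \<Rightarrow> 'b \<Rightarrow> 'a list \<Rightarrow> 'b list" where
  "code idx zero one w = concat (map (\<lambda>a. replicate (idx a) one @ [zero]) w)"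

lemma code_simps [simp]:
  "code idx zero one [] = []"
  "code idx zero one (u @ v) = code idx zero one u @ code idx zero one v"
  "code idx zero one (a # v) = replicate (idx a) one @ [zero] @ code idx zero one v"
  by (simp_all add: code_def)

lemma set_code: "set (code idx zero one w) \<subseteq> {zero, one}"
  by (induction w) auto

lemma unary_inj:
  assumes "zero \<noteq> one" "replicate m one @ zero # u = replicate n one @ zero # v"
  shows "m = n \<and> u = v"
proof -
  have "takeWhile (\<lambda>x. x = one) (replicate k one @ zero # w) = replicate k one" for k w
    using assms(1) by (induction k) auto
  with assms(2) have "replicate m one = replicate n one" by metis
  then have "m = n" by (metis length_replicate)
  with assms(2) show ?thesis by simp
qed

lemma code_inj:
  assumes "zero \<noteq> one" "inj_on idx A" "set u \<subseteq> A" "set v \<subseteq> A"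
    "code idx zero one u = code idx zero one v"
  shows "u = v"
  using assms(3-5)
proof (induction u arbitrary: v)
  case Nil
  then show ?case by (cases v) auto
next
  case (Cons a u)
  then obtain b v' where v: "v = b # v'" by (cases v) auto
  with Cons.prems(3) have "idx a = idx b \<and> code idx zero one u = code idx zero one v'"
    by (intro unary_inj[OF assms(1)]) simp
  then show ?case using Cons.IH[of v'] Cons.prems v inj_onD[OF assms(2), of a b] by auto
qed

section \<open>The history grammar\<close>

text \<open>\<open>d\<close> ends each sentential form of \<open>H\<close> in a history; it occurs
  only in coded form. \<open>s\<close> starts, \<open>A\<close> writes pairs, and \<open>B\<close>
  writes the last form.\<close>

locale history_grammar =
  fixes H :: "'a ugrammar" and zero one hash d s A B :: 'a and idx :: "'a \<Rightarrow> nat"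
  assumes ugr: "is_ugrammar H"
    and bits: "distinct [zero, one, hash]"
    and fresh: "distinct [d, s, A, B]" "set [d, s, A, B] \<inter> (uV H \<union> {zero, one, hash}) = {}"
    and idx: "inj_on idx (insert d (uV H))"
begin

abbreviation c where "c \<equiv> code idx zero one"

definition W where "W = {zero, one, hash}"
definition T where "T = uT H - W"
text \<open>A row of pairs between two separators rewrites some parts of a form by rules and copies
  the others, so it stands for any number of parallel steps. \<open>d\<close> is only ever
  copied.\<close>

definition pairs where "pairs = uP H \<union> (\<lambda>a. ([a], [a])) ` insert d (uV H)"

definition lhs where "lhs ps = concat (map fst ps)"
definition rhs where "rhs ps = concat (map snd ps)"

text \<open>The start rule puts \<open>[uS H, d]\<close> on the right side only, which produces the
  offset by one form. The symbols of \<open>W\<close> are nonterminals without rules.\<close>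

definition G where
  "G = \<lparr>cV = T \<union> W \<union> {s, A, B}, cT = T,
     cP = {(s, A # rev (c [uS H, d])), (A, [B]), (B, c [d] @ [hash])}
       \<union> (\<lambda>(u, v). (A, c u @ [A] @ rev (c v))) ` pairs
       \<union> (\<lambda>a. (B, c [a] @ [a, B])) ` T,
     cS = s\<rparr>"

section \<open>Pair sequences as histories of derivations\<close>

lemma uP_D: "(x, y) \<in> uP H \<Longrightarrow> set x \<subseteq> uV H \<and> set y \<subseteq> uV H"
  using ugr unfolding is_ugrammar_def by blast

lemma lhs_rhs_simps [simp]:
  "lhs [] = []" "lhs (p # ps) = fst p @ lhs ps" "lhs (ps @ qs) = lhs ps @ lhs qs"
  "rhs [] = []" "rhs (p # ps) = snd p @ rhs ps" "rhs (ps @ qs) = rhs ps @ rhs qs"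
  by (simp_all add: lhs_def rhs_def)

lemma lhs_rhs_id [simp]: "lhs (map (\<lambda>a. ([a], [a])) w) = w" "rhs (map (\<lambda>a. ([a], [a])) w) = w"
  by (induction w) auto

lemma pairs_set: "set ps \<subseteq> pairs \<Longrightarrow> set (lhs ps) \<subseteq> insert d (uV H) \<and> set (rhs ps) \<subseteq> insert d (uV H)"
proof (induction ps)
  case (Cons p ps)
  have "set (fst p) \<subseteq> insert d (uV H) \<and> set (snd p) \<subseteq> insert d (uV H)"
    using Cons.prems uP_D[of "fst p" "snd p"] unfolding pairs_def by auto
  with Cons show ?case by auto
qed simp

lemma sets: "T \<subseteq> uV H" "T \<inter> W = {}" "d \<notin> uV H" "d \<notin> T" "uS H \<in> uV H" "{s, A, B} \<inter> (T \<union> W) = {}"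
  using ugr fresh unfolding is_ugrammar_def T_def W_def by auto

lemma no_d:
  assumes "set ps \<subseteq> pairs - {([d], [d])}"
  shows "d \<notin> set (lhs ps) \<and> d \<notin> set (rhs ps) \<and> (u_step H)\<^sup>*\<^sup>* (lhs ps) (rhs ps)"
  using assms
proof (induction ps)
  case (Cons p ps)
  have "d \<notin> set (fst p) \<and> d \<notin> set (snd p) \<and> (rw_step (uP H))\<^sup>*\<^sup>* (fst p) (snd p)"
  proof (cases "p \<in> uP H")
    case True
    then show ?thesis using uP_D[of "fst p" "snd p"] sets rw_rule[of "fst p" "snd p" "uP H"] by auto
  next
    case False
    then show ?thesis using Cons.prems sets unfolding pairs_def by auto
  qed
  moreover have "d \<notin> set (lhs ps) \<and> d \<notin> set (rhs ps) \<and> (rw_step (uP H))\<^sup>*\<^sup>* (lhs ps) (rhs ps)"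
    using Cons unfolding u_step_eq by simp
  ultimately show ?case unfolding u_step_eq by (auto intro: rw_steps_append)
qed simp

text \<open>Both sides are cut at their first \<open>d\<close>. The first row derives the second
  form from \<open>x\<close>, and what remains is the same equation for that form and a shorter list
  of pairs.\<close>

lemma history_sound:
  assumes "set ps \<subseteq> pairs" "lhs ps @ z @ [d] = x @ [d] @ rhs ps" "d \<notin> set x" "d \<notin> set z"
  shows "(u_step H)\<^sup>*\<^sup>* x z"
  using assms(1-3)
proof (induction "length ps" arbitrary: ps x rule: less_induct)
  case less
  show ?case
  proof (cases "([d], [d]) \<in> set ps")
    case False
    with less.prems(1) have ps: "set ps \<subseteq> pairs - {([d], [d])}" by auto
    have "(lhs ps @ z) @ d # [] = x @ d # rhs ps" using less.prems(2) by simp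
    \<comment> \<open>Here \<open>ps\<close> need not be empty: its pairs may erase, and then
      \<open>lhs ps\<close> in front of \<open>z\<close> derives the empty word.\<close>
    then have "lhs ps @ z = x \<and> [] = rhs ps"
      using no_d[OF ps] assms(4) append_Cons_eq_iff[of d "lhs ps @ z" "[]"] by auto
    then show ?thesis
      using no_d[OF ps] rw_steps_context[of "uP H" "lhs ps" "rhs ps" "[]" z] unfolding u_step_eq by auto
  next
    case True
    then obtain ps1 ps2 where ps: "ps = ps1 @ ([d], [d]) # ps2" "([d], [d]) \<notin> set ps1"
      using split_list_first by metis
    with less.prems(1) have ps1: "set ps1 \<subseteq> pairs - {([d], [d])}" by auto
    have "x @ d # (rhs ps1 @ d # rhs ps2) = lhs ps1 @ d # (lhs ps2 @ z @ [d])"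
      using less.prems(2) ps(1) by simp
    then have e: "x = lhs ps1" "rhs ps1 @ d # rhs ps2 = lhs ps2 @ z @ [d]"
      using no_d[OF ps1] less.prems(3) append_Cons_eq_first by metis+
    have "(u_step H)\<^sup>*\<^sup>* (rhs ps1) z"
      by (rule less.hyps[of ps2]) (use ps e less.prems(1) no_d[OF ps1] in auto)
    then show ?thesis using no_d[OF ps1] e(1) by auto
  qed
qed

text \<open>Each step of \<open>H\<close> contributes one row: its rule once, all other symbols
  copied, then the separator.\<close>

lemma history_complete:
  assumes "(u_step H)\<^sup>*\<^sup>* x z" "set x \<subseteq> uV H"
  shows "\<exists>ps. set ps \<subseteq> pairs \<and> lhs ps @ z @ [d] = x @ [d] @ rhs ps"
  using assms
proof (induction rule: converse_rtranclp_induct)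
  case base
  show ?case by (intro exI[of _ "[]"]) simp
next
  case (step x x')
  from step.hyps(1) obtain u v l r where lr: "(l, r) \<in> uP H" "x = u @ l @ v" "x' = u @ r @ v"
    unfolding u_step_def by blast
  have "set x' \<subseteq> uV H" using step.prems lr uP_D[OF lr(1)] by auto
  with step.IH obtain ps where ps: "set ps \<subseteq> pairs" "lhs ps @ z @ [d] = x' @ [d] @ rhs ps" by blast
  let ?m = "map (\<lambda>a. ([a], [a]))"
  have "set (?m u @ (l, r) # ?m v @ ([d], [d]) # ps) \<subseteq> pairs"
    using ps(1) lr step.prems unfolding pairs_def by auto
  then show ?case using ps(2) lr
    by (intro exI[of _ "?m u @ (l, r) # ?m v @ ([d], [d]) # ps"]) simp
qed

section \<open>Sentential forms of the history grammar\<close>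

text \<open>The last form is needed twice, coded for the comparison and in clear for the output; the
  projections to \<open>W\<close> and \<open>T\<close> separate the two.\<close>

definition emit where "emit z = concat (map (\<lambda>a. c [a] @ [a]) z)"

lemma emit_simps [simp]: "emit [] = []" "emit (u @ v) = emit u @ emit v" "emit [a] = c [a] @ [a]"
  by (simp_all add: emit_def)

lemma set_c: "set (c w) \<subseteq> {zero, one}"
  by (rule set_code)

lemma set_emit: "set z \<subseteq> T \<Longrightarrow> set (emit z) \<subseteq> T \<union> {zero, one}"
  by (induction z) (auto simp: emit_def)

text \<open>The middle \<open>m\<close> records the phase: writing pairs, writing the last form,
  finished. Apart from \<open>[s]\<close>, the symbols \<open>s\<close>, \<open>A\<close>,
  \<open>B\<close> can occur only in \<open>m\<close>.\<close>

lemma sentential_forms: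
  assumes "(cfg_step G)\<^sup>*\<^sup>* [s] w"
  shows "w = [s] \<or> (\<exists>ps z m. set ps \<subseteq> pairs \<and> set z \<subseteq> T \<and>
      (m = [A] \<and> z = [] \<or> m = [B] \<or> m = c [d] @ [hash]) \<and>
      w = c (lhs ps) @ emit z @ m @ rev (c ([uS H, d] @ rhs ps)))"
  using assms
proof (induction rule: rtranclp_induct)
  case (step w1 w2)
  from step.hyps(2) obtain u v X r where r: "(X, r) \<in> cP G" "w1 = u @ X # v" "w2 = u @ r @ v"
    unfolding cfg_step_def by auto
  have X: "X \<in> {s, A, B}" using r(1) unfolding G_def by auto
  show ?case
  proof (cases "w1 = [s]")
    case True
    then have "u = []" "v = []" "X = s" using r(2) by (auto simp: append_eq_Cons_conv)
    then have "w2 = A # rev (c [uS H, d])" using r fresh unfolding G_def by auto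
    then show ?thesis by (intro disjI2 exI[of _ "[]"] exI[of _ "[A]"]) auto
  next
    case False
    with step.IH obtain ps z m where w1: "set ps \<subseteq> pairs" "set z \<subseteq> T"
      "m = [A] \<and> z = [] \<or> m = [B] \<or> m = c [d] @ [hash]"
      "w1 = c (lhs ps) @ emit z @ m @ rev (c ([uS H, d] @ rhs ps))" by blast
    define p where "p = c (lhs ps) @ emit z"
    define q where "q = rev (c ([uS H, d] @ rhs ps))"
    have "set (c x) \<subseteq> W" for x using set_c[of x] by (auto simp: W_def)
    moreover have "set (emit z) \<subseteq> T \<union> W" using set_emit[OF w1(2)] by (auto simp: W_def)
    ultimately have "set p \<subseteq> T \<union> W" "set q \<subseteq> T \<union> W" "set (c [d] @ [hash]) \<subseteq> T \<union> W"
      unfolding p_def q_def set_append set_rev by (auto simp: W_def simp del: code_simps)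
    moreover have "X \<notin> T \<union> W" using X sets(6) by auto
    ultimately have pq: "X \<notin> set p" "X \<notin> set q" "X \<notin> set (c [d] @ [hash])" by blast+
    have w1': "w1 = p @ m @ q" using w1 by (simp add: p_def q_def)
    \<comment> \<open>Both flanks lie over \<open>T\<close> and \<open>W\<close>, so the rewritten
      nonterminal is the middle itself.\<close>
    have "X \<in> set (p @ m @ q)" unfolding w1'[symmetric] r(2) by simp
    then have "X \<in> set m" using pq by simp
    then have m: "m = [X]" "X = A \<and> z = [] \<or> X = B" using w1(3) pq(3) by auto
    have "p @ X # q = u @ X # v" using r(2) w1' m by simp
    then have uv: "u = p" "v = q" using pq by (auto simp: append_Cons_eq_iff)
    have AB: "A \<noteq> s" "B \<noteq> s" "A \<noteq> B" using fresh by auto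
    from m(2) show ?thesis
    proof
      assume XA: "X = A \<and> z = []"
      with r(1) AB consider "r = [B]" | x y where "(x, y) \<in> pairs" "r = c x @ [A] @ rev (c y)"
        unfolding G_def by auto
      then show ?thesis
      proof cases
        case 1
        then show ?thesis using r uv w1 XA
          by (intro disjI2 exI[of _ ps] exI[of _ "[]"] exI[of _ "[B]"]) (simp add: p_def q_def)
      next
        case 2
        then show ?thesis using r uv w1 XA
          \<comment> \<open>The new pair goes to the end of \<open>ps\<close>: its second code is
            inserted next to \<open>A\<close>, which is the end of the right side before
            reversal.\<close>
          by (intro disjI2 exI[of _ "ps @ [(x, y)]"] exI[of _ "[]"] exI[of _ "[A]"]) (simp add: p_def q_def)
      qed
    next
      assume XB: "X = B"
      with r(1) AB consider "r = c [d] @ [hash]" | a where "a \<in> T" "r = c [a] @ [a, B]"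
        unfolding G_def by auto
      then show ?thesis
      proof cases
        case 1
        then show ?thesis using r uv w1
          by (intro disjI2 exI[of _ ps] exI[of _ z] exI[of _ "c [d] @ [hash]"]) (simp add: p_def q_def)
      next
        case 2
        then show ?thesis using r uv w1
          by (intro disjI2 exI[of _ ps] exI[of _ "z @ [a]"] exI[of _ "[B]"]) (simp add: p_def q_def)
      qed
    qed
  qed
qed simp

lemma final_form:
  assumes "set ps \<subseteq> pairs" "set z \<subseteq> T"
  shows "(cfg_step G)\<^sup>*\<^sup>* [s] (c (lhs ps) @ emit z @ c [d] @ [hash] @ rev (c ([uS H, d] @ rhs ps)))"
proof -
  let ?q = "rev (c ([uS H, d] @ rhs ps))"
  have step: "(X, r) \<in> cP G \<Longrightarrow> (cfg_step G)\<^sup>*\<^sup>* w (u @ [X] @ v) \<Longrightarrow> (cfg_step G)\<^sup>*\<^sup>* w (u @ r @ v)"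
    for X r w u v
    unfolding cfg_step_eq by (erule rtranclp.rtrancl_into_rtrancl, rule rw_stepI) (auto simp: cf_rules_def)
  have "(cfg_step G)\<^sup>*\<^sup>* [s] (c (lhs ps) @ [A] @ ?q)"
    using assms(1)
  proof (induction ps rule: rev_induct)
    case Nil
    show ?case using step[of s "A # rev (c [uS H, d])" "[s]" "[]" "[]"] by (simp add: G_def)
  next
    case (snoc p ps)
    have "(A, c (fst p) @ [A] @ rev (c (snd p))) \<in> cP G"
      using snoc.prems unfolding G_def by force
    from step[OF this snoc.IH] show ?case using snoc.prems by simp
  qed
  then have "(cfg_step G)\<^sup>*\<^sup>* [s] (c (lhs ps) @ [B] @ ?q)"
    by (rule step[rotated]) (simp add: G_def)
  moreover have "(cfg_step G)\<^sup>*\<^sup>* [s] ((c (lhs ps) @ emit z) @ [B] @ ?q)"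
    using assms(2)
  proof (induction z rule: rev_induct)
    case Nil
    show ?case using calculation by simp
  next
    case (snoc a z)
    have "(B, c [a] @ [a, B]) \<in> cP G" using snoc.prems unfolding G_def by auto
    from step[OF this snoc.IH] show ?case using snoc.prems by simp
  qed
  moreover have "(B, c [d] @ [hash]) \<in> cP G" by (simp add: G_def)
  ultimately show ?thesis using step[of B "c [d] @ [hash]" "[s]" "c (lhs ps) @ emit z" ?q] by simp
qed

section \<open>The constrained language of the history grammar\<close>

lemma proj_c: "proj W (c w) = c w" "proj T (c w) = []"
  using set_c[of w] sets by (auto simp: W_def intro!: proj_all proj_none)

lemma proj_emit: "set z \<subseteq> T \<Longrightarrow> proj W (emit z) = c z \<and> proj T (emit z) = z"
proof (induction z)
  case (Cons a z)
  have "emit (a # z) = c [a] @ [a] @ emit z" by (simp add: emit_def)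
  then show ?case using Cons sets proj_c[of "[a]"] by auto
qed simp

lemma proj_final:
  assumes "set z \<subseteq> T"
  shows "proj W (c u @ emit z @ c [d] @ [hash] @ rev (c v)) = c (u @ z @ [d]) @ [hash] @ rev (c v)"
    "proj T (c u @ emit z @ c [d] @ [hash] @ rev (c v)) = z"
proof -
  have "hash \<in> W" "hash \<notin> T" using sets by (auto simp: W_def T_def)
  then show "proj W (c u @ emit z @ c [d] @ [hash] @ rev (c v)) = c (u @ z @ [d]) @ [hash] @ rev (c v)"
    "proj T (c u @ emit z @ c [d] @ [hash] @ rev (c v)) = z"
    using proj_emit[OF assms] proj_c by (simp_all del: code_simps(3))
qed

text \<open>Codes contain no \<open>hash\<close>, so the only separator marks the centre.\<close>

lemma pal_iff: "c u @ [hash] @ rev (c v) \<in> Fpal zero one hash \<longleftrightarrow> c u = c v"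
proof
  assume "c u @ [hash] @ rev (c v) \<in> Fpal zero one hash"
  then obtain w where w: "set w \<subseteq> {zero, one}" "c u @ hash # rev (c v) = w @ hash # rev w"
    unfolding Fpal_def by (auto simp: lists_eq_set)
  have "hash \<notin> set (c u)" "hash \<notin> set (rev (c v))"
    using set_c[of u] set_c[of v] bits by auto
  then show "c u = c v" using w by (auto simp: append_Cons_eq_iff)
next
  assume "c u = c v"
  moreover have "c v \<in> lists {zero, one}" using set_c[of v] by (auto simp: lists_eq_set)
  ultimately show "c u @ [hash] @ rev (c v) \<in> Fpal zero one hash"
    unfolding Fpal_def by auto
qed

lemma N_minus_W: "cN G - W = {s, A, B}"
  using sets unfolding cN_def G_def by auto

text \<open>Excluding \<open>s\<close>, \<open>A\<close>, \<open>B\<close> leaves finished forms,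
  and for these the palindrome condition is, by \<open>code_inj\<close>, the equation of
  \<open>history_sound\<close> and \<open>history_complete\<close> with
  \<open>x = [uS H]\<close>.\<close>

lemma LGF_G: "LGF G {zero, one, hash} (Fpal zero one hash) = {z \<in> u_lang H. set z \<inter> W = {}}"
proof (intro set_eqI iffI)
  fix z assume "z \<in> LGF G {zero, one, hash} (Fpal zero one hash)"
  then obtain y where y: "z = proj T y" "(cfg_step G)\<^sup>*\<^sup>* [s] y" "proj W y \<in> Fpal zero one hash"
    "set y \<inter> {s, A, B} = {}"
    unfolding LGF_def phiF_def phi_def W_def[symmetric] N_minus_W proj_empty_iff by (auto simp: G_def)
  from sentential_forms[OF y(2)] y(4) obtain ps t where ps: "set ps \<subseteq> pairs" "set t \<subseteq> T"
    and y': "y = c (lhs ps) @ emit t @ c [d] @ [hash] @ rev (c ([uS H, d] @ rhs ps))"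
    by auto
  have zt: "z = t" unfolding y(1) y' proj_final(2)[OF ps(2)] ..
  have "c (lhs ps @ t @ [d]) = c ([uS H, d] @ rhs ps)"
    using y(3) unfolding y' proj_final(1)[OF ps(2)] pal_iff .
  then have "lhs ps @ t @ [d] = [uS H, d] @ rhs ps"
    using bits pairs_set[OF ps(1)] ps(2) sets by (intro code_inj[OF _ idx]) auto
  then have "lhs ps @ t @ [d] = [uS H] @ [d] @ rhs ps" by simp
  then have "(u_step H)\<^sup>*\<^sup>* [uS H] t"
    using sets ps(2) by (intro history_sound[OF ps(1)]) auto
  then show "z \<in> {z \<in> u_lang H. set z \<inter> W = {}}"
    using zt ps(2) unfolding u_lang_def T_def by auto
next
  fix z assume "z \<in> {z \<in> u_lang H. set z \<inter> W = {}}"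
  then have z: "set z \<subseteq> T" "(u_step H)\<^sup>*\<^sup>* [uS H] z" unfolding u_lang_def T_def by auto
  obtain ps where ps: "set ps \<subseteq> pairs" "lhs ps @ z @ [d] = [uS H] @ [d] @ rhs ps"
    using history_complete[OF z(2)] sets by auto
  define y where "y = c (lhs ps) @ emit z @ c [d] @ [hash] @ rev (c ([uS H, d] @ rhs ps))"
  have "(cfg_step G)\<^sup>*\<^sup>* [s] y" unfolding y_def by (rule final_form[OF ps(1) z(1)])
  moreover have "c (lhs ps @ z @ [d]) = c ([uS H, d] @ rhs ps)" using ps(2) by simp
  then have "proj W y \<in> Fpal zero one hash" unfolding y_def proj_final(1)[OF z(1)] pal_iff .
  moreover have "set y \<subseteq> T \<union> W"
    using set_c[of "lhs ps"] set_c[of "[uS H, d] @ rhs ps"] set_c[of "[d]"] set_emit[OF z(1)]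
    unfolding y_def set_append set_rev W_def by auto
  then have "set y \<inter> {s, A, B} = {}" using sets(6) by auto
  moreover have "z = proj T y" unfolding y_def proj_final(2)[OF z(1)] ..
  ultimately show "z \<in> LGF G {zero, one, hash} (Fpal zero one hash)"
    unfolding LGF_def phiF_def phi_def W_def[symmetric] N_minus_W proj_empty_iff by (auto simp: G_def)
qed

lemma is_cfg_G: "is_cfg G" and propagating_G: "propagating G"
proof -
  have fin: "finite (uP H)" "finite (uV H)" using ugr unfolding is_ugrammar_def by auto
  then have "finite T" "finite pairs"
    using sets(1) finite_subset unfolding pairs_def by auto
  moreover have "set (c w) \<subseteq> W" for w using set_c[of w] by (auto simp: W_def)
  moreover have "zero \<in> W" "one \<in> W" "hash \<in> W" by (auto simp: W_def)
  ultimately show "is_cfg G"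
    using sets(2,6) unfolding is_cfg_def cN_def G_def by (auto simp del: code_simps) (auto simp: W_def)
  show "propagating G" unfolding propagating_def G_def by auto
qed

end

section \<open>The equivalence\<close>

theorem theorem2:
  fixes L :: "'a list set" and zero one hash :: 'a
  assumes "infinite (UNIV :: 'a set)"
    and "distinct [zero, one, hash]"
    and "\<forall>w \<in> L. set w \<inter> {zero, one, hash} = {}"
  shows "recursively_enumerable L \<longleftrightarrow>
    (\<exists>G. is_cfg G \<and> propagating G \<and> {zero, one, hash} \<subseteq> cV G
       \<and> L = LGF G {zero, one, hash} (Fpal zero one hash))"
proof
  assume "recursively_enumerable L"
  then obtain H where H: "is_ugrammar H" "u_lang H = L" unfolding recursively_enumerable_def by blast
  have fin: "finite (uV H)" using H(1) unfolding is_ugrammar_def by blast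
  then obtain f :: "nat \<Rightarrow> 'a" where f: "inj f" "\<And>n. f n \<notin> uV H \<union> {zero, one, hash}"
    using fresh_sequence[OF assms(1), of "uV H \<union> {zero, one, hash}"] by auto
  obtain idx :: "'a \<Rightarrow> nat" where "inj_on idx (insert (f 0) (uV H))"
    using fin finite_imp_inj_to_nat_seg[of "insert (f 0) (uV H)"] by auto
  \<comment> \<open>The fresh symbols serve in turn as \<open>d\<close>, \<open>s\<close>,
    \<open>A\<close>, \<open>B\<close>.\<close>
  then interpret history_grammar H zero one hash "f 0" "f 1" "f 2" "f 3" idx
    using H(1) assms(2) f by unfold_locales (auto simp: inj_eq)
  \<comment> \<open>Words of \<open>L\<close> avoid \<open>W\<close>, so the restriction in
    \<open>LGF_G\<close> removes nothing.\<close>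
  have "L = LGF G {zero, one, hash} (Fpal zero one hash)"
    using assms(3) H(2) unfolding LGF_G W_def by blast
  moreover have "{zero, one, hash} \<subseteq> cV G" unfolding G_def W_def by auto
  ultimately show "\<exists>G. is_cfg G \<and> propagating G \<and> {zero, one, hash} \<subseteq> cV G
       \<and> L = LGF G {zero, one, hash} (Fpal zero one hash)"
    using is_cfg_G propagating_G by blast
next
  assume "\<exists>G. is_cfg G \<and> propagating G \<and> {zero, one, hash} \<subseteq> cV G
       \<and> L = LGF G {zero, one, hash} (Fpal zero one hash)"
  then obtain G where G: "is_cfg G" "{zero, one, hash} \<subseteq> cV G"
    "L = LGF G {zero, one, hash} (Fpal zero one hash)" by blast
  have "finite (cV G)" using G(1) unfolding is_cfg_def by blast
  from fresh_sequence[OF assms(1) this] obtain f :: "nat \<Rightarrow> 'a"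
    where f: "inj f" "\<And>n. f n \<notin> cV G" by blast
  \<comment> \<open>The fresh symbols serve as the three frozen copies, \<open>K\<close> and
    \<open>start\<close>.\<close>
  interpret checking_grammar G zero one hash "f 0" "f 1" "f 2" "f 3" "f 4"
    using G assms(2) f by unfold_locales (auto simp: inj_eq)
  show "recursively_enumerable L"
    using u_lang_H[OF G(3) assms(3)] is_ugrammar_H unfolding recursively_enumerable_def by blast
qed

end
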